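(* No realiser for $\mathsf{HBC}$ is computable (in the sense of Kleene's schemes S1–S9) in any functional of type 2. That is, for every functional $\beta$ of type 3 such that, for all closed $C\subseteq[0,1]$ and all sequences of rationals $(a_n)_{n\in\mathbb{N}},(b_n)_{n\in\mathbb{N}}$ with $C\subseteq\bigcup_{n\in\mathbb{N}}(a_n,b_n)$, one has $C\subseteq\bigcup_{n\le\beta(C,(a_n),(b_n))}(a_n,b_n)$, and for every type-2 functional $F$, $\beta$ is not Kleene-computable in $F$.
   Context: Computability is Kleene's higher-order computability given by schemes S1–S9; metatheory ZFC. Reals are represented by fast-converging Cauchy sequences of rationals. A set of reals is given by a function $Y:\mathbb{R}\to\mathbb{R}$ (a type-2 object), where $x\in Y$ means $Y(x)>0$; $Y$ is open if for every $x\in Y$ there is a rational $r>0$ with $B(x,r)\subseteq Y$; $Y$ is closed if its complement is open. $\mathsf{HBC}$ is the statement: for every closed $C\subseteq[0,1]$ and sequences of reals $(a_n),(b_n)$ with $C\subseteq\bigcup_{n}(a_n,b_n)$, there is $n_0$ with $C\subseteq\bigcup_{n\le n_0}(a_n,b_n)$. *)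

theory Defs
  imports Complex_Main "HOL-Library.Countable" "HOL-Library.Nat_Bijection"
begin

section \<open>Kleene's schemes S1--S9\<close>

type_synonym type1 = "nat \<Rightarrow> nat"
type_synonym type2 = "type1 \<Rightarrow> nat"

text \<open>
  Arguments are grouped by type, as in Kleene's treatment: a list of numbers, a list of type-1
  objects and a list of pure type-2 objects.  Only arguments of type at most 2 are needed to say
  that a type-3 functional is computable in a type-2 functional: no scheme creates an argument of
  a type higher than those already present (S4, S5, S8 for a type-2 object add numbers, the other
  schemes add nothing), so on such arguments the relation below is the full Kleene computation
  relation.
\<close>

text \<open>The signature: the number of arguments of each type.\<close>

definition signature :: "nat list \<Rightarrow> type1 list \<Rightarrow> type2 list \<Rightarrow> nat" where
  "signature xs fs Fs = list_encode [length xs, length fs, length Fs]"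

definition to_front :: "nat \<Rightarrow> 'a list \<Rightarrow> 'a list" where
  "to_front k xs = xs ! k # take k xs @ drop (Suc k) xs"

text \<open>
  \<open>kleene e xs fs Fs z\<close> means that \<open>{e}(xs, fs, Fs)\<close> converges with value \<open>z\<close>.  Following Kleene,
  an index is the code of a tuple (number of the scheme, signature, further data), and it converges
  only on arguments of its own signature.
\<close>

inductive kleene :: "nat \<Rightarrow> nat list \<Rightarrow> type1 list \<Rightarrow> type2 list \<Rightarrow> nat \<Rightarrow> bool" where
  S1: "kleene (list_encode [1, signature (x # xs) fs Fs]) (x # xs) fs Fs (Suc x)"
| S2: "kleene (list_encode [2, signature xs fs Fs, q]) xs fs Fs q"
| S3: "kleene (list_encode [3, signature (x # xs) fs Fs]) (x # xs) fs Fs x"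
| S4: "kleene h xs fs Fs y \<Longrightarrow> kleene g (y # xs) fs Fs z \<Longrightarrow>
       kleene (list_encode [4, signature xs fs Fs, g, h]) xs fs Fs z"
| S5_zero: "kleene g xs fs Fs z \<Longrightarrow>
       kleene (list_encode [5, signature (0 # xs) fs Fs, g, h]) (0 # xs) fs Fs z"
| S5_Suc: "kleene (list_encode [5, signature (x # xs) fs Fs, g, h]) (x # xs) fs Fs y \<Longrightarrow>
       kleene h (x # y # xs) fs Fs z \<Longrightarrow>
       kleene (list_encode [5, signature (Suc x # xs) fs Fs, g, h]) (Suc x # xs) fs Fs z"
| S6_0: "k < length xs \<Longrightarrow> kleene g (to_front k xs) fs Fs z \<Longrightarrow>
       kleene (list_encode [6, signature xs fs Fs, 0, k, g]) xs fs Fs z"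
| S6_1: "k < length fs \<Longrightarrow> kleene g xs (to_front k fs) Fs z \<Longrightarrow>
       kleene (list_encode [6, signature xs fs Fs, 1, k, g]) xs fs Fs z"
| S6_2: "k < length Fs \<Longrightarrow> kleene g xs fs (to_front k Fs) z \<Longrightarrow>
       kleene (list_encode [6, signature xs fs Fs, 2, k, g]) xs fs Fs z"
| S7: "kleene (list_encode [7, signature (x # xs) (f # fs) Fs]) (x # xs) (f # fs) Fs (f x)"
| S8: "(\<And>n. kleene h (n # xs) fs (F # Fs) (f n)) \<Longrightarrow>
       kleene (list_encode [8, signature xs fs (F # Fs), 2, h]) xs fs (F # Fs) (F f)"
| S9: "kleene e xs fs Fs z \<Longrightarrow>
       kleene (list_encode [9, signature (e # xs @ xs') (fs @ fs') (Fs @ Fs'), signature xs fs Fs])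
         (e # xs @ xs') (fs @ fs') (Fs @ Fs') z"


section \<open>Reals, sets of reals and realisers\<close>

text \<open>Fast-converging Cauchy sequences of rationals; \<open>nat_to_rat_surj\<close> is an explicit enumeration.\<close>

definition represents_real :: "type1 \<Rightarrow> real \<Rightarrow> bool" where
  "represents_real f x \<longleftrightarrow>
     (\<forall>n i. \<bar>nat_to_rat_surj (f n) - nat_to_rat_surj (f (n + i))\<bar> < 1 / 2 ^ n) \<and>
     (\<lambda>n. real_of_rat (nat_to_rat_surj (f n))) \<longlonglongrightarrow> x"

definition represents_fun :: "(type1 \<Rightarrow> type1) \<Rightarrow> (real \<Rightarrow> real) \<Rightarrow> bool" where
  "represents_fun \<Phi> Y \<longleftrightarrow> (\<forall>f x. represents_real f x \<longrightarrow> represents_real (\<Phi> f) (Y x))"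

definition pos_set :: "(real \<Rightarrow> real) \<Rightarrow> real set" where
  "pos_set Y = {x. Y x > 0}"

definition rat_interval :: "type1 \<Rightarrow> type1 \<Rightarrow> nat \<Rightarrow> real set" where
  "rat_interval a b n =
     {real_of_rat (nat_to_rat_surj (a n)) <..< real_of_rat (nat_to_rat_surj (b n))}"

text \<open>
  A candidate realiser is applied to a representation of the function giving the set and to the two
  sequences of codes of rationals.
\<close>

type_synonym type3 = "(type1 \<Rightarrow> type1) \<Rightarrow> type1 \<Rightarrow> type1 \<Rightarrow> nat"

definition HBC_realiser :: "type3 \<Rightarrow> bool" where
  "HBC_realiser \<beta> \<longleftrightarrow>
     (\<forall>\<Phi> Y a b.
        represents_fun \<Phi> Y \<and> closed (pos_set Y) \<and> pos_set Y \<subseteq> {0..1} \<and>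
        pos_set Y \<subseteq> (\<Union>n. rat_interval a b n)
        \<longrightarrow> pos_set Y \<subseteq> (\<Union>n\<le>\<beta> \<Phi> a b. rat_interval a b n))"

text \<open>
  The pure type-2 object coding an object of type \<open>1 \<rightarrow> 1\<close>: its value at the sequence
  \<open>m, f 0, f 1, \<dots>\<close> is \<open>\<Phi> f m\<close>.
\<close>

definition pure :: "(type1 \<Rightarrow> type1) \<Rightarrow> type2" where
  "pure \<Phi> h = \<Phi> (\<lambda>n. h (Suc n)) (h 0)"

text \<open>
  One index has to compute \<open>\<beta>\<close> from \<open>F\<close> on all inputs \<open>(Y, a, b)\<close> with \<open>Y\<close> a function on the reals
  (not only on those to which HBC applies).  Nothing is asked at type \<open>1 \<rightarrow> 1\<close> objects that do
  not represent a function on the reals.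
\<close>

definition computable_in :: "type3 \<Rightarrow> type2 \<Rightarrow> bool" where
  "computable_in \<beta> F \<longleftrightarrow>
     (\<exists>e. \<forall>\<Phi> a b. (\<exists>Y. represents_fun \<Phi> Y) \<longrightarrow> kleene e [] [a, b] [pure \<Phi>, F] (\<beta> \<Phi> a b))"

end

theory Submission
  imports Defs "HOL-Analysis.Continuum_Not_Denumerable"
begin

text \<open>
  A terminating Kleene computation is a well-founded tree with countable branching, so it evaluates
  its type-2 arguments at only countably many points, whatever the functional \<open>F\<close> is.
  Run \<open>\<beta>\<close> on the empty set and the intervals \<open>(1 / (n + 2), 2)\<close>, which cover \<open>(0, 1]\<close>, and let \<open>N\<close>
  be the result.  Some \<open>x \<in> (0, 1 / (N + 2))\<close> is not represented by any of the countably many points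
  queried, so \<open>\<beta>\<close> also returns \<open>N\<close> on \<open>{x}\<close>, although no interval with \<open>n \<le> N\<close> contains \<open>x\<close>.
\<close>

section \<open>Inversion and determinism of Kleene computations\<close>

declare list_encode.simps [simp del]

lemma signature_eq_iff:
  "signature xs fs Fs = signature ys gs Gs \<longleftrightarrow>
     length xs = length ys \<and> length fs = length gs \<and> length Fs = length Gs"
  by (simp add: signature_def list_encode_eq)

\<comment> \<open>An index carries its scheme number, so injectivity of \<open>list_encode\<close>
  leaves one rule per pattern; the two rules of S5 are told apart by the leading number, those of S6
  by the type selector.\<close>
inductive_simps kleene_scheme [simplified list_encode_eq, simplified]:
  "kleene (list_encode [1, s]) xs fs Fs z"
  "kleene (list_encode [2, s, q]) xs fs Fs z"
  "kleene (list_encode [3, s]) xs fs Fs z"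
  "kleene (list_encode [4, s, g, h]) xs fs Fs z"
  "kleene (list_encode [5, s, g, h]) (0 # xs) fs Fs z"
  "kleene (list_encode [5, s, g, h]) (Suc x # xs) fs Fs z"
  "kleene (list_encode [6, s, 0, k, g]) xs fs Fs z"
  "kleene (list_encode [6, s, 1, k, g]) xs fs Fs z"
  "kleene (list_encode [6, s, 2, k, g]) xs fs Fs z"
  "kleene (list_encode [7, s]) xs fs Fs z"
  "kleene (list_encode [8, s, 2, h]) xs fs Fs z"
  "kleene (list_encode [9, s, t]) xs fs Fs z"

text \<open>Induction on the first computation, inverting the second: index and arguments together
  fix the scheme and its subcomputations.\<close>

lemma kleene_functional:
  "kleene e xs fs Fs y \<Longrightarrow> kleene e xs fs Fs z \<Longrightarrow> y = z"
proof (induction arbitrary: z rule: kleene.induct)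
  case (S4 h xs fs Fs y g z')
  then show ?case
    unfolding kleene_scheme by blast
next
  case (S5_zero g xs fs Fs z' h)
  then show ?case
    unfolding kleene_scheme by blast
next
  case (S5_Suc x xs fs Fs g h y z')
  from S5_Suc.prems obtain y'
    where "kleene (list_encode [5, signature (x # xs) fs Fs, g, h]) (x # xs) fs Fs y'"
      and "kleene h (x # y' # xs) fs Fs z"
    unfolding kleene_scheme(6) by (auto simp: signature_def)
  then show ?case
    using S5_Suc.IH by blast
next
  case (S6_0 k xs g fs Fs z')
  then show ?case
    unfolding kleene_scheme by blast
next
  case (S6_1 k fs g xs Fs z')
  from S6_1.prems have "kleene g xs (to_front k fs) Fs z"
    by (simp add: kleene_scheme)
  then show ?case
    by (rule S6_1.IH)
next
  case (S6_2 k Fs g xs fs z')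
  then show ?case
    unfolding kleene_scheme by blast
next
  case (S8 h xs fs F Fs f)
  from S8.prems obtain g where g: "\<And>n. kleene h (n # xs) fs (F # Fs) (g n)" and z: "z = F g"
    by (auto simp: kleene_scheme)
  \<comment> \<open>The induction hypothesis identifies the two oracle arguments value by value, so
    extensionality applies.\<close>
  have "f = g"
    by (rule ext) (rule S8.IH[OF g])
  with z show ?case
    by simp
next
  case (S9 e xs fs Fs z' xs' fs' Fs')
  from S9.prems obtain ys ys' gs gs' Gs Gs' where
      "signature xs fs Fs = signature ys gs Gs"
      "xs @ xs' = ys @ ys'" "fs @ fs' = gs @ gs'" "Fs @ Fs' = Gs @ Gs'"
    and z: "kleene e ys gs Gs z"
    unfolding kleene_scheme list.inject by (elim exE conjE) (rule that; simp only:)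
  \<comment> \<open>The inner signature stored in the index fixes the lengths of the prefixes, so
    the argument lists split in only one way.\<close>
  then have "ys = xs" "gs = fs" "Gs = Fs"
    unfolding signature_eq_iff by simp_all
  with z show ?case
    by (blast intro: S9.IH)
qed (auto simp: kleene_scheme)

section \<open>Countable use of type-2 arguments\<close>

abbreviation agree_on :: "type1 set \<Rightarrow> type2 list \<Rightarrow> type2 list \<Rightarrow> bool" where
  "agree_on Q \<equiv> list_all2 (\<lambda>F G. \<forall>f\<in>Q. F f = G f)"

lemma agree_on_subset: "agree_on Q Fs Gs \<Longrightarrow> P \<subseteq> Q \<Longrightarrow> agree_on P Fs Gs"
  by (erule list_all2_mono) blast

lemma list_all2_to_front:
  assumes "list_all2 P xs ys" "k < length xs"
  shows "list_all2 P (to_front k xs) (to_front k ys)"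
  using assms by (simp add: to_front_def list_all2_appendI list_all2_nthD)

lemma signature_agree_on: "agree_on Q Fs Gs \<Longrightarrow> signature xs fs Fs = signature xs fs Gs"
  by (simp add: signature_eq_iff list_all2_lengthD)

text \<open>Only S8 adds a new query point; the other schemes inherit or join the sets of their
  subcomputations. One set serves all positions of the list, so S6 may permute it and S9 truncate
  it. Signatures see only lengths, so the index stays valid for \<open>Gs\<close>.\<close>

lemma kleene_countable_use:
  "kleene e xs fs Fs z \<Longrightarrow>
     \<exists>Q. countable Q \<and> (\<forall>Gs. agree_on Q Fs Gs \<longrightarrow> kleene e xs fs Gs z)"
proof (induction rule: kleene.induct)
  case (S1 x xs fs Fs)
  show ?case
    by (intro exI[of _ "{}"] conjI countable_empty allI impI)
      (simp only: signature_agree_on kleene.S1)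
next
  case (S2 xs fs Fs q)
  show ?case
    by (intro exI[of _ "{}"] conjI countable_empty allI impI)
      (simp only: signature_agree_on kleene.S2)
next
  case (S3 x xs fs Fs)
  show ?case
    by (intro exI[of _ "{}"] conjI countable_empty allI impI)
      (simp only: signature_agree_on kleene.S3)
next
  case (S4 h xs fs Fs y g z)
  then obtain P Q where
      P: "countable P" "\<And>Gs. agree_on P Fs Gs \<Longrightarrow> kleene h xs fs Gs y"
    and Q: "countable Q" "\<And>Gs. agree_on Q Fs Gs \<Longrightarrow> kleene g (y # xs) fs Gs z"
    by blast
  have "kleene (list_encode [4, signature xs fs Fs, g, h]) xs fs Gs z"
    if "agree_on (P \<union> Q) Fs Gs" for Gs
  proof -
    have "agree_on P Fs Gs" "agree_on Q Fs Gs"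
      using agree_on_subset[OF that] by simp_all
    then show ?thesis
      using P(2) Q(2) unfolding signature_agree_on[OF that] by (blast intro: kleene.S4)
  qed
  with P(1) Q(1) show ?case
    by (intro exI[of _ "P \<union> Q"]) auto
next
  case (S5_zero g xs fs Fs z h)
  then obtain Q where Q: "countable Q" "\<And>Gs. agree_on Q Fs Gs \<Longrightarrow> kleene g xs fs Gs z"
    by blast
  from Q show ?case
    by (intro exI[of _ Q] conjI allI impI) (simp_all only: signature_agree_on kleene.S5_zero)
next
  case (S5_Suc x xs fs Fs g h y z)
  then obtain P Q where
      P: "countable P" "\<And>Gs. agree_on P Fs Gs \<Longrightarrow>
            kleene (list_encode [5, signature (x # xs) fs Fs, g, h]) (x # xs) fs Gs y"
    and Q: "countable Q" "\<And>Gs. agree_on Q Fs Gs \<Longrightarrow> kleene h (x # y # xs) fs Gs z"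
    by blast
  have "kleene (list_encode [5, signature (Suc x # xs) fs Fs, g, h]) (Suc x # xs) fs Gs z"
    if "agree_on (P \<union> Q) Fs Gs" for Gs
  proof -
    have "agree_on P Fs Gs" "agree_on Q Fs Gs"
      using agree_on_subset[OF that] by simp_all
    then show ?thesis
      using P(2)[of Gs] Q(2)[of Gs] unfolding signature_agree_on[OF that]
      by (intro kleene.S5_Suc) simp_all
  qed
  with P(1) Q(1) show ?case
    by (intro exI[of _ "P \<union> Q"]) auto
next
  case (S6_0 k xs g fs Fs z)
  then obtain Q where Q: "countable Q" "\<And>Gs. agree_on Q Fs Gs \<Longrightarrow> kleene g (to_front k xs) fs Gs z"
    by blast
  with S6_0.hyps(1) show ?case
    by (intro exI[of _ Q] conjI allI impI) (simp_all only: signature_agree_on kleene.S6_0)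
next
  case (S6_1 k fs g xs Fs z)
  then obtain Q where Q: "countable Q" "\<And>Gs. agree_on Q Fs Gs \<Longrightarrow> kleene g xs (to_front k fs) Gs z"
    by blast
  with S6_1.hyps(1) show ?case
    by (intro exI[of _ Q] conjI allI impI) (simp_all only: signature_agree_on kleene.S6_1)
next
  case (S6_2 k Fs g xs fs z)
  then obtain Q where
    Q: "countable Q" "\<And>Gs. agree_on Q (to_front k Fs) Gs \<Longrightarrow> kleene g xs fs Gs z"
    by blast
  have "kleene (list_encode [6, signature xs fs Fs, 2, k, g]) xs fs Gs z"
    if H: "agree_on Q Fs Gs" for Gs
    unfolding signature_agree_on[OF H]
  proof (rule kleene.S6_2)
    show "k < length Gs"
      using S6_2.hyps(1) list_all2_lengthD[OF H] by simp
    show "kleene g xs fs (to_front k Gs) z"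
      by (rule Q(2)[OF list_all2_to_front[OF H S6_2.hyps(1)]])
  qed
  with Q(1) show ?case
    by blast
next
  case (S7 x xs f fs Fs)
  show ?case
    by (intro exI[of _ "{}"] conjI countable_empty allI impI)
      (simp only: signature_agree_on kleene.S7)
next
  case (S8 h xs fs F Fs f)
  from S8.IH have "\<forall>n. \<exists>Q. countable Q \<and>
      (\<forall>Gs. agree_on Q (F # Fs) Gs \<longrightarrow> kleene h (n # xs) fs Gs (f n))"
    by (rule allI)
  then obtain Q where Q: "\<forall>n. countable (Q n) \<and>
      (\<forall>Gs. agree_on (Q n) (F # Fs) Gs \<longrightarrow> kleene h (n # xs) fs Gs (f n))"
    by (rule choice[THEN exE])
  \<comment> \<open>Agreement on every \<open>Q n\<close> makes the subcomputations yield the same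
    \<open>f\<close> under \<open>Gs\<close>; agreement at \<open>f\<close> itself then gives the
    same oracle answer.\<close>
  define R where "R = insert f (\<Union>n. Q n)"
  have "kleene (list_encode [8, signature xs fs (F # Fs), 2, h]) xs fs Gs (F f)"
    if R: "agree_on R (F # Fs) Gs" for Gs
  proof -
    obtain G Gs' where Gs: "Gs = G # Gs'" and "F f = G f"
      using R by (auto simp: list_all2_Cons1 R_def)
    moreover have "kleene h (n # xs) fs Gs (f n)" for n
      by (rule Q[rule_format, THEN conjunct2, rule_format], rule agree_on_subset[OF R])
        (auto simp: R_def)
    ultimately show ?thesis
      unfolding signature_agree_on[OF R] by (simp only: kleene.S8)
  qed
  moreover have "countable R"
    using Q by (simp add: R_def)
  ultimately show ?case
    by blast
next
  case (S9 e xs fs Fs z xs' fs' Fs')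
  then obtain Q where Q: "countable Q" "\<And>Gs. agree_on Q Fs Gs \<Longrightarrow> kleene e xs fs Gs z"
    by blast
  have "kleene (list_encode [9, signature (e # xs @ xs') (fs @ fs') (Fs @ Fs'), signature xs fs Fs])
          (e # xs @ xs') (fs @ fs') Hs z" if H: "agree_on Q (Fs @ Fs') Hs" for Hs
  proof -
    obtain Gs Gs' where Hs: "Hs = Gs @ Gs'" and Gs: "agree_on Q Fs Gs"
      using H by (auto simp: list_all2_append1)
    show ?thesis
      unfolding signature_agree_on[OF H] signature_agree_on[OF Gs] Hs
      by (intro kleene.S9 Q(2) Gs)
  qed
  with Q(1) show ?case
    by blast
qed

section \<open>Representing the empty set and singletons\<close>

definition rat_code :: "rat \<Rightarrow> nat" where
  "rat_code q = inv nat_to_rat_surj q"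

lemma nat_to_rat_surj_rat_code [simp]: "nat_to_rat_surj (rat_code q) = q"
  by (simp add: rat_code_def surj_f_inv_f surj_nat_to_rat_surj)

lemma represents_real_const: "represents_real (\<lambda>_. rat_code q) (real_of_rat q)"
  by (simp add: represents_real_def)

lemma represents_real_unique: "represents_real f x \<Longrightarrow> represents_real f y \<Longrightarrow> x = y"
  unfolding represents_real_def by (blast intro: LIMSEQ_unique)

definition const_rep :: "rat \<Rightarrow> type1 \<Rightarrow> type1" where
  "const_rep q f = (\<lambda>_. rat_code q)"

text \<open>The case distinction is not effective, but inputs may be arbitrary functionals. Even at
  sequences representing no real, it equals \<open>const_rep 0\<close> unless \<open>f\<close>
  represents \<open>x\<close>.\<close>

definition singleton_rep :: "real \<Rightarrow> type1 \<Rightarrow> type1" where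
  "singleton_rep x f = (if represents_real f x then const_rep 1 f else const_rep 0 f)"

lemma represents_fun_const_rep: "represents_fun (const_rep q) (\<lambda>_. real_of_rat q)"
  by (simp add: represents_fun_def const_rep_def represents_real_const)

lemma represents_fun_singleton_rep: "represents_fun (singleton_rep x) (\<lambda>y. of_bool (y = x))"
  unfolding represents_fun_def
  using represents_real_const[of 0] represents_real_const[of 1] represents_real_unique
  by (auto simp: singleton_rep_def const_rep_def of_bool_def)

lemma pure_singleton_rep:
  assumes "\<not> represents_real (\<lambda>n. h (Suc n)) x"
  shows "pure (singleton_rep x) h = pure (const_rep 0) h"
  using assms by (simp add: pure_def singleton_rep_def const_rep_def)

text \<open>Each sequence represents at most one real, so the set lies in an image of
  \<open>Q\<close>.\<close>

lemma countable_represented: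
  assumes "countable Q"
  shows "countable {x. \<exists>h\<in>Q. represents_real (\<lambda>n. h (Suc n)) x}"
proof -
  have "{x. \<exists>h\<in>Q. represents_real (\<lambda>n. h (Suc n)) x}
          \<subseteq> (\<lambda>h. THE x. represents_real (\<lambda>n. h (Suc n)) x) ` Q"
    by (force intro: the_equality[symmetric] dest: represents_real_unique)
  with assms show ?thesis
    by (meson countable_image countable_subset)
qed

section \<open>Defeating a computable realiser with a singleton\<close>

theorem theorem3p10:
  fixes \<beta> :: type3 and F :: type2
  assumes "HBC_realiser \<beta>"
  shows "\<not> computable_in \<beta> F"
proof
  assume "computable_in \<beta> F"
  then obtain e where
    e: "\<And>\<Phi> a b Y. represents_fun \<Phi> Y \<Longrightarrow> kleene e [] [a, b] [pure \<Phi>, F] (\<beta> \<Phi> a b)"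
    unfolding computable_in_def by blast
  \<comment> \<open>The left endpoints decrease to 0, so the intervals with index at most
    \<open>N\<close> cover only \<open>(1 / (N + 2), 2)\<close>.\<close>
  define a where "a n = rat_code (1 / of_nat (n + 2))" for n
  define b where "b n = rat_code 2" for n :: nat
  have interval: "rat_interval a b n = {1 / real (n + 2) <..< 2}" for n
    by (simp add: rat_interval_def a_def b_def of_rat_divide of_rat_add)
  define N where "N = \<beta> (const_rep 0) a b"
  \<comment> \<open>\<open>Q\<close> is fixed before \<open>x\<close> is chosen, so \<open>x\<close>
    can avoid every real represented by the tail of a point of \<open>Q\<close>.\<close>
  obtain Q where Q: "countable Q"
    "\<And>Gs. agree_on Q [pure (const_rep 0), F] Gs \<Longrightarrow> kleene e [] [a, b] Gs N"
    using kleene_countable_use[OF e[OF represents_fun_const_rep]] unfolding N_def by blast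
  have "uncountable {0 <..< 1 / real (N + 2)}"
    by (simp add: uncountable_open_interval)
  then have "\<not> {0 <..< 1 / real (N + 2)} \<subseteq> {x. \<exists>h\<in>Q. represents_real (\<lambda>n. h (Suc n)) x}"
    by (rule contrapos_nn) (rule countable_subset[OF _ countable_represented[OF Q(1)]])
  then obtain x where x: "x \<in> {0 <..< 1 / real (N + 2)}"
    and fresh: "\<And>h. h \<in> Q \<Longrightarrow> \<not> represents_real (\<lambda>n. h (Suc n)) x"
    by blast
  have "kleene e [] [a, b] [pure (singleton_rep x), F] N"
    using fresh by (intro Q(2)) (simp add: pure_singleton_rep)
  \<comment> \<open>The same computation also converges to the value of \<open>\<beta>\<close>,
    because \<open>singleton_rep x\<close> represents a function on the reals; determinism equates
    the two.\<close>
  then have same: "\<beta> (singleton_rep x) a b = N"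
    using e[OF represents_fun_singleton_rep] kleene_functional by blast
  define Y :: "real \<Rightarrow> real" where "Y y = of_bool (y = x)" for y
  have pos: "pos_set Y = {x}"
    by (auto simp: pos_set_def Y_def)
  have "0 < x" "x < 1 / real (N + 2)"
    using x by (simp_all only: greaterThanLessThan_iff)
  moreover have "1 / real (N + 2) \<le> 1"
    by simp
  ultimately have "0 < x" "x < 1"
    by linarith+
  obtain n where "inverse (real (Suc n)) < x"
    using reals_Archimedean[OF \<open>0 < x\<close>] by blast
  moreover have "1 / real (n + 2) \<le> inverse (real (Suc n))"
    by (simp add: field_simps)
  ultimately have "x \<in> rat_interval a b n"
    using \<open>x < 1\<close> by (simp add: interval)
  then have "pos_set Y \<subseteq> (\<Union>n. rat_interval a b n)"
    unfolding pos by blast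
  moreover have "represents_fun (singleton_rep x) Y"
    using represents_fun_singleton_rep by (simp add: Y_def[abs_def])
  moreover have "closed (pos_set Y)" "pos_set Y \<subseteq> {0..1}"
    using \<open>0 < x\<close> \<open>x < 1\<close> by (simp_all add: pos)
  ultimately have "pos_set Y \<subseteq> (\<Union>n\<le>\<beta> (singleton_rep x) a b. rat_interval a b n)"
    by (intro assms[unfolded HBC_realiser_def, rule_format] conjI)
  then have "x \<in> (\<Union>n\<le>N. rat_interval a b n)"
    by (simp only: pos same insert_subset)
  \<comment> \<open>A covering interval with index \<open>m \<le> N\<close> would force
    \<open>1 / (N + 2) < x\<close>, against the choice of \<open>x\<close>.\<close>
  then obtain m where "m \<le> N" "1 / real (m + 2) < x"
    by (auto simp: interval)
  moreover from \<open>m \<le> N\<close> have "1 / real (N + 2) \<le> 1 / real (m + 2)"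
    by (simp add: frac_le)
  ultimately show False
    using x by simp
qed

end
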